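(* For every integer $n\geq 1$, the equilateral dimension of the Heisenberg group $\mathfrak{H}^n=\mathbb{C}^n\times\mathbb{R}$ with the Korányi (Cygan) metric $d_{\mathrm{Cyg}}$ satisfies $$\dim_{\mathrm E}(\mathfrak{H}^n)=2n+2.$$ Equivalently, $\mathfrak{H}^n$ contains an equilateral set with exactly $2n+2$ points, and no equilateral set in $\mathfrak{H}^n$ has more points.
   Context: On $\mathbb{C}^n$ use the standard Hermitian inner product $\langle z,w\rangle=\sum_{j=1}^n z_j\overline{w_j}$ and $\|z\|^2=\langle z,z\rangle$. The $n$-th Heisenberg group is $\mathfrak{H}^n=\mathbb{C}^n\times\mathbb{R}$, with elements written $[z,t]$ and group law $[z,t]\cdot[w,s]=[z+w,\,t+s+2\operatorname{Im}\langle z,w\rangle]$; thus $[z,t]^{-1}=[-z,-t]$. The Cygan gauge is $\|[z,t]\|_{\mathrm{Cyg}}=(\|z\|^4+t^2)^{1/4}$, and the Korányi (also called Cygan) metric is $d_{\mathrm{Cyg}}([z,t],[w,s])=\|[w,s]^{-1}\cdot[z,t]\|_{\mathrm{Cyg}}$, i.e. $$d_{\mathrm{Cyg}}([z,t],[w,s])=\left[\|z-w\|^4+\left(t-s+2\operatorname{Im}\langle z,w\rangle\right)^2\right]^{1/4}.$$ In a metric space $(X,d)$, an equilateral set is a subset such that all distances between pairs of distinct points of it are equal. The equilateral dimension $\dim_{\mathrm E}(X)$ is the supremum of the cardinalities of finite equilateral subsets of $X$. *)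

theory Defs
  imports "HOL-Analysis.Analysis" "HOL-Library.Extended_Nat"
begin

section \<open>Equilateral sets in a metric space\<close>

context Metric_space
begin

definition equilateral :: "'a set \<Rightarrow> bool" where
  "equilateral S \<longleftrightarrow> S \<subseteq> M \<and> (\<exists>c. pairwise (\<lambda>x y. d x y = c) S)"

text \<open>A supremum in \<^typ>\<open>enat\<close>, so that it is \<^term>\<open>\<infinity>\<close> when the cardinalities are unbounded.\<close>

definition equilateral_dim :: enat where
  "equilateral_dim = (SUP S \<in> {S. finite S \<and> equilateral S}. enat (card S))"

end


section \<open>The Heisenberg group with the Cygan metric\<close>

text \<open>
  The dimension \<open>n \<ge> 1\<close> is \<^term>\<open>CARD('n)\<close>. The component-wise addition and the product metric which
  the library puts on this type are not the Heisenberg group law and the Cygan metric.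
\<close>

type_synonym 'n heisenberg = "(complex ^ 'n) \<times> real"

definition hermitian :: "complex ^ ('n::finite) \<Rightarrow> complex ^ 'n \<Rightarrow> complex" where
  "hermitian z w = (\<Sum>j\<in>UNIV. z $ j * cnj (w $ j))"

lemma hermitian_self: "hermitian z z = of_real ((norm z)\<^sup>2)"
  by (simp add: hermitian_def norm_vec_def L2_set_def sum_nonneg complex_mult_cnj cmod_power2)

fun heis_mult :: "'n::finite heisenberg \<Rightarrow> 'n heisenberg \<Rightarrow> 'n heisenberg" where
  "heis_mult (z, t) (w, s) = (z + w, t + s + 2 * Im (hermitian z w))"

fun heis_inv :: "'n::finite heisenberg \<Rightarrow> 'n heisenberg" where
  "heis_inv (z, t) = (- z, - t)"

fun cygan_gauge :: "'n::finite heisenberg \<Rightarrow> real" where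
  "cygan_gauge (z, t) = root 4 (norm z ^ 4 + t\<^sup>2)"

definition cygan_dist :: "'n::finite heisenberg \<Rightarrow> 'n heisenberg \<Rightarrow> real" where
  "cygan_dist p q = cygan_gauge (heis_mult (heis_inv q) p)"

lemma hermitian_add_left: "hermitian (x + y) w = hermitian x w + hermitian y w"
  by (simp add: hermitian_def distrib_right sum.distrib)

lemma hermitian_add_right: "hermitian w (x + y) = hermitian w x + hermitian w y"
  by (simp add: hermitian_def distrib_left sum.distrib)

lemma hermitian_minus_left: "hermitian (- x) w = - hermitian x w"
  by (simp add: hermitian_def sum_negf)

lemma hermitian_minus_right: "hermitian w (- x) = - hermitian w x"
  by (simp add: hermitian_def sum_negf)

lemma hermitian_commute: "hermitian w z = cnj (hermitian z w)"
  by (simp add: hermitian_def mult.commute)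

lemma norm_hermitian_le: "norm (hermitian z w) \<le> norm z * norm w"
proof -
  have "norm (hermitian z w) \<le> (\<Sum>j\<in>UNIV. \<bar>norm (z $ j)\<bar> * \<bar>norm (w $ j)\<bar>)"
    unfolding hermitian_def by (rule sum_norm_le) (simp add: norm_mult)
  also have "\<dots> \<le> norm z * norm w"
    unfolding norm_vec_def by (rule L2_set_mult_ineq)
  finally show ?thesis .
qed

lemma heis_mult_assoc: "heis_mult (heis_mult p q) r = heis_mult p (heis_mult q r)"
  by (cases p; cases q; cases r) (simp add: hermitian_add_left hermitian_add_right)

lemma heis_mult_zero: "heis_mult (0, 0) p = p" "heis_mult p (0, 0) = p"
  by (cases p; simp add: hermitian_def)+

lemma heis_mult_inv: "heis_mult (heis_inv p) p = (0, 0)" "heis_mult p (heis_inv p) = (0, 0)"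
  by (cases p; simp add: hermitian_minus_left hermitian_minus_right hermitian_self)+

lemma cygan_dist_eq:
  "cygan_dist (z, t) (w, s) = root 4 (norm (z - w) ^ 4 + (t - s + 2 * Im (hermitian z w))\<^sup>2)"
  by (simp add: cygan_dist_def hermitian_minus_left hermitian_commute [of w z])

lemma cygan_gauge_nonneg: "0 \<le> cygan_gauge p"
  by (cases p) simp

lemma cygan_gauge_power2: "(cygan_gauge (z, t))\<^sup>2 = cmod (Complex ((norm z)\<^sup>2) (- t))"
proof -
  have "root 4 x = sqrt (sqrt x)" for x
    using real_root_mult_exp [of 2 2 x] by (simp add: sqrt_def)
  then show ?thesis
    by (simp add: cmod_def power_mult [symmetric])
qed

lemma cygan_gauge_mult_le: "cygan_gauge (heis_mult p q) \<le> cygan_gauge p + cygan_gauge q"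
proof -
  obtain z t where p: "p = (z, t)" by (cases p)
  obtain w s where q: "q = (w, s)" by (cases q)
  define A where "A = (\<lambda>(z :: complex ^ 'a) t. Complex ((norm z)\<^sup>2) (- t))"
  have le: "norm z \<le> cygan_gauge (z, t)" for z :: "complex ^ 'a" and t
  proof (rule power2_le_imp_le)
    show "(norm z)\<^sup>2 \<le> (cygan_gauge (z, t))\<^sup>2"
      unfolding cygan_gauge_power2
      using complex_Re_le_cmod [of "Complex ((norm z)\<^sup>2) (- t)"] by simp
  qed (rule cygan_gauge_nonneg)
  have "complex_of_real ((norm (z + w))\<^sup>2)
      = of_real ((norm z)\<^sup>2) + of_real ((norm w)\<^sup>2) + (hermitian z w + cnj (hermitian z w))"
    by (simp only: hermitian_self [symmetric] hermitian_add_left hermitian_add_right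
        hermitian_commute [of w z] ac_simps)
  then have "(norm (z + w))\<^sup>2 = (norm z)\<^sup>2 + (norm w)\<^sup>2 + 2 * Re (hermitian z w)"
    by (simp only: complex_add_cnj of_real_add [symmetric] of_real_eq_iff)
  then have "A (z + w) (t + s + 2 * Im (hermitian z w)) = A z t + A w s + 2 * cnj (hermitian z w)"
    by (simp add: A_def complex_eq_iff)
  then have "(cygan_gauge (heis_mult p q))\<^sup>2 = cmod (A z t + A w s + 2 * cnj (hermitian z w))"
    by (simp only: p q heis_mult.simps cygan_gauge_power2 A_def)
  also have "\<dots> \<le> cmod (A z t) + cmod (A w s) + 2 * norm (hermitian z w)"
    by (intro norm_triangle_le add_mono norm_triangle_ineq) (simp add: norm_mult)
  also have "\<dots> \<le> (cygan_gauge p)\<^sup>2 + (cygan_gauge q)\<^sup>2 + 2 * (cygan_gauge p * cygan_gauge q)"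
  proof -
    have "norm (hermitian z w) \<le> norm z * norm w"
      by (rule norm_hermitian_le)
    also have "\<dots> \<le> cygan_gauge p * cygan_gauge q"
      unfolding p q by (intro mult_mono le cygan_gauge_nonneg norm_ge_zero)
    finally show ?thesis
      by (simp only: p q cygan_gauge_power2 A_def)
  qed
  also have "\<dots> = (cygan_gauge p + cygan_gauge q)\<^sup>2"
    by (simp add: power2_sum)
  finally show ?thesis
    by (rule power2_le_imp_le) (simp add: cygan_gauge_nonneg)
qed

lemma Metric_space_cygan: "Metric_space UNIV cygan_dist"
proof
  fix p q r :: "'a heisenberg"
  show "0 \<le> cygan_dist p q"
    by (simp add: cygan_dist_def cygan_gauge_nonneg)
  obtain z t w s where pq: "p = (z, t)" "q = (w, s)"
    by (cases p; cases q)
  have "t - s + 2 * Im (hermitian z w) = - (s - t + 2 * Im (hermitian w z))"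
    by (simp add: hermitian_commute [of w z])
  then show "cygan_dist p q = cygan_dist q p"
    unfolding pq cygan_dist_eq by (simp only: power2_minus norm_minus_commute)
  have "norm (z - w) ^ 4 + (t - s + 2 * Im (hermitian z w))\<^sup>2 = 0 \<longleftrightarrow> z = w \<and> t = s"
    by (subst add_nonneg_eq_0_iff) (auto simp: hermitian_self)
  then show "cygan_dist p q = 0 \<longleftrightarrow> p = q"
    by (simp add: pq cygan_dist_eq)
  have "heis_mult (heis_inv r) p = heis_mult (heis_mult (heis_inv r) q) (heis_mult (heis_inv q) p)"
    by (metis heis_mult_assoc heis_mult_inv(2) heis_mult_zero(1))
  then show "cygan_dist p r \<le> cygan_dist p q + cygan_dist q r"
    unfolding cygan_dist_def by (metis cygan_gauge_mult_le add.commute)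
qed

global_interpretation cygan: Metric_space UNIV cygan_dist
  by (rule Metric_space_cygan)

end

theory Submission
  imports Defs
begin

text \<open>
  Upper bound: \<open>2n + 3\<close> points \<open>p\<^sub>i = [z\<^sub>i, t\<^sub>i]\<close> of \<open>\<complex>\<^sup>n \<times> \<real>\<close> have a real affine dependence \<open>w\<close>. In
  \<open>\<Sum> w\<^sub>i w\<^sub>j d(p\<^sub>i, p\<^sub>j)\<^sup>4\<close> all terms cancel except \<open>2 (\<Sum> w\<^sub>i \<parallel>z\<^sub>i\<parallel>\<^sup>2)\<^sup>2\<close> and \<open>4 \<Sum> w\<^sub>i w\<^sub>j \<bar>\<langle>z\<^sub>i, z\<^sub>j\<rangle>\<bar>\<^sup>2\<close>, both
  nonnegative; but if all distances equal \<open>c\<close>, the sum is \<open>- c\<^sup>4 \<Sum> w\<^sub>i\<^sup>2 < 0\<close>.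

  Lower bound: take the vertices \<open>f\<^sub>0, \<dots>, f\<^sub>n\<close> of a regular simplex in \<open>\<real>\<^sup>n\<close> centred at \<open>0\<close> and the points
  \<open>[\<alpha> f\<^sub>j, \<tau>]\<close> and \<open>[\<beta> f\<^sub>j, 0]\<close> with \<open>\<bar>\<alpha>\<bar> = \<bar>\<beta>\<bar> = 1/\<surd>2\<close>. The distance between a point of the first kind and one
  of the second takes only two values, and \<open>\<alpha>\<close>, \<open>\<beta>\<close> and \<open>\<tau>\<close> can be chosen so that both are \<open>1\<close>.
\<close>

section \<open>Hermitian form and powers of the Cygan distance\<close>

lemma cygan_dist_power4:
  "cygan_dist (z, t) (w, s) ^ 4 = norm (z - w) ^ 4 + (t - s + 2 * Im (hermitian z w))\<^sup>2"
  by (simp add: cygan_dist_eq)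

lemma hermitian_diff_left: "hermitian (x - y) w = hermitian x w - hermitian y w"
  by (simp add: hermitian_def left_diff_distrib sum_subtractf)

lemma hermitian_diff_right: "hermitian w (x - y) = hermitian w x - hermitian w y"
  by (simp add: hermitian_def right_diff_distrib sum_subtractf)

lemma hermitian_scale_left: "hermitian (c *s x) w = c * hermitian x w"
  by (simp add: hermitian_def sum_distrib_left mult_ac)

lemma hermitian_scale_right: "hermitian w (c *s x) = cnj c * hermitian w x"
  by (simp add: hermitian_def sum_distrib_left mult_ac)

lemma hermitian_sum_scaleR_right:
  "hermitian z (\<Sum>i\<in>S. c i *\<^sub>R v i) = (\<Sum>i\<in>S. c i * hermitian z (v i))"
  unfolding hermitian_def
  by (simp add: sum_distrib_left sum.swap [of _ S] scaleR_conv_of_real [where 'a = complex] mult_ac)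

lemma norm_diff_hermitian:
  "(norm (z - w))\<^sup>2 = (norm z)\<^sup>2 + (norm w)\<^sup>2 - 2 * Re (hermitian z w)"
proof -
  have "complex_of_real ((norm (z - w))\<^sup>2)
      = of_real ((norm z)\<^sup>2) + of_real ((norm w)\<^sup>2) - (hermitian z w + cnj (hermitian z w))"
    unfolding hermitian_self [symmetric] hermitian_diff_left hermitian_diff_right
      hermitian_commute [of w z] by simp
  then show ?thesis
    by (simp only: complex_add_cnj of_real_add [symmetric] of_real_diff [symmetric] of_real_eq_iff)
qed

text \<open>The complex number inside the modulus is linear in the Hermitian product, so the lower
  bound reduces to placing complex numbers on the unit circle.\<close>

lemma cygan_dist_power2:
  "(cygan_dist (z, t) (w, s))\<^sup>2
     = cmod (of_real ((norm z)\<^sup>2 + (norm w)\<^sup>2) - \<i> * of_real (t - s) - 2 * hermitian z w)"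
proof -
  define H where
    "H = of_real ((norm z)\<^sup>2 + (norm w)\<^sup>2) - \<i> * of_real (t - s) - 2 * hermitian z w"
  have H: "Re H = (norm (z - w))\<^sup>2" "Im H = - (t - s + 2 * Im (hermitian z w))"
    by (simp_all add: H_def norm_diff_hermitian)
  have "((cygan_dist (z, t) (w, s))\<^sup>2)\<^sup>2
      = ((norm (z - w))\<^sup>2)\<^sup>2 + (t - s + 2 * Im (hermitian z w))\<^sup>2"
    using cygan_dist_power4 [of z t w s] by simp
  also have "\<dots> = (cmod H)\<^sup>2"
    unfolding cmod_power2 H power2_minus ..
  finally show ?thesis
    unfolding H_def by (rule power2_eq_imp_eq) simp_all
qed

section \<open>Upper bound\<close>

text \<open>The squared modulus of \<open>hermitian (v i) (v j)\<close> is the Frobenius product of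
  the rank-one matrices \<open>v_i v_i^*\<close> and \<open>v_j v_j^*\<close>. So the sum is the
  squared Frobenius norm of their combination \<open>m\<close> with weights
  \<open>c\<close>.\<close>

lemma sum_sum_norm_hermitian_nonneg:
  fixes v :: "'a \<Rightarrow> complex ^ 'n::finite" and c :: "'a \<Rightarrow> real"
  shows "0 \<le> (\<Sum>i\<in>S. \<Sum>j\<in>S. c i * c j * (cmod (hermitian (v i) (v j)))\<^sup>2)"
proof -
  define m where "m k l = (\<Sum>i\<in>S. c i * (v i $ k * cnj (v i $ l)))" for k l
  have "complex_of_real (\<Sum>i\<in>S. \<Sum>j\<in>S. c i * c j * (cmod (hermitian (v i) (v j)))\<^sup>2)
      = (\<Sum>i\<in>S. \<Sum>j\<in>S. c i * c j * (hermitian (v i) (v j) * cnj (hermitian (v i) (v j))))"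
    by (simp add: complex_norm_square flip: of_real_power)
  also have "\<dots> = (\<Sum>i\<in>S. \<Sum>j\<in>S. \<Sum>k\<in>UNIV. \<Sum>l\<in>UNIV.
      (c i * (v i $ k * cnj (v i $ l))) * cnj (c j * (v j $ k * cnj (v j $ l))))"
    unfolding hermitian_def cnj_sum sum_product unfolding sum_distrib_left
    by (intro sum.cong refl) (simp add: mult_ac)
  also have "\<dots> = (\<Sum>k\<in>UNIV. \<Sum>l\<in>UNIV. \<Sum>i\<in>S. \<Sum>j\<in>S.
      (c i * (v i $ k * cnj (v i $ l))) * cnj (c j * (v j $ k * cnj (v j $ l))))"
    by (simp only: sum.swap [of _ UNIV S])
  also have "\<dots> = (\<Sum>k\<in>UNIV. \<Sum>l\<in>UNIV. m k l * cnj (m k l))"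
    by (simp only: m_def cnj_sum sum_product)
  also have "\<dots> = of_real (\<Sum>k\<in>UNIV. \<Sum>l\<in>UNIV. (cmod (m k l))\<^sup>2)"
    by (simp add: complex_norm_square flip: of_real_power)
  finally show ?thesis
    by (simp only: of_real_eq_iff) (simp add: sum_nonneg)
qed

lemma cygan_affine_dependence_nonneg:
  fixes S :: "'n::finite heisenberg set"
  assumes w0: "sum w S = 0" and wS: "(\<Sum>p\<in>S. w p *\<^sub>R p) = 0"
  shows "0 \<le> (\<Sum>p\<in>S. \<Sum>q\<in>S. w p * w q * cygan_dist p q ^ 4)"
proof -
  have wz: "(\<Sum>p\<in>S. w p *\<^sub>R fst p) = 0"
    using arg_cong [OF wS, of fst] by (simp add: fst_sum)
  have wt: "(\<Sum>p\<in>S. w p * snd p) = 0"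
    using arg_cong [OF wS, of snd] by (simp add: snd_sum)
  have wh: "(\<Sum>q\<in>S. w q * hermitian z (fst q)) = 0" for z
    using hermitian_sum_scaleR_right [of z w fst S] by (simp add: wz hermitian_def)
  have wRe: "(\<Sum>q\<in>S. w q * Re (hermitian z (fst q))) = 0"
    and wIm: "(\<Sum>q\<in>S. w q * Im (hermitian z (fst q))) = 0" for z
    using arg_cong [OF wh, of Re] arg_cong [OF wh, of Im] by simp_all
  define N where "N p = (norm (fst p))\<^sup>2" for p :: "'n heisenberg"
  define h where "h p q = hermitian (fst p) (fst q)" for p q :: "'n heisenberg"
  define B where "B p q = N p * N p + snd p * snd p + 2 * N p * N q - 2 * snd p * snd q
    - 4 * N p * Re (h p q) + 4 * snd p * Im (h p q) - 4 * N q * Re (h p q) - 4 * snd q * Im (h p q)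
    + N q * N q + snd q * snd q + 4 * (cmod (h p q))\<^sup>2" for p q
  have d: "cygan_dist p q ^ 4 = B p q" for p q
  proof -
    have "cygan_dist p q ^ 4 = (N p + N q - 2 * Re (h p q))\<^sup>2 + (snd p - snd q + 2 * Im (h p q))\<^sup>2"
      using cygan_dist_power4 [of "fst p" "snd p" "fst q" "snd q"]
      by (simp add: N_def h_def flip: norm_diff_hermitian)
    then show ?thesis
      unfolding B_def cmod_power2 by (simp add: power2_eq_square algebra_simps)
  qed
  \<comment> \<open>A term vanishes once \<open>w\<close> annihilates a factor holding all its
    dependence on one variable: a constant, \<open>snd\<close>, or a part of \<open>h\<close>. Here
    that variable is \<open>q\<close>; in \<open>left\<close> it is \<open>p\<close>.\<close>
  have right: "(\<Sum>p\<in>S. \<Sum>q\<in>S. w p * w q * (f p * g p q)) = 0"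
    if "\<And>p. (\<Sum>q\<in>S. w q * g p q) = 0" for f and g :: "'n heisenberg \<Rightarrow> 'n heisenberg \<Rightarrow> real"
  proof -
    have "(\<Sum>q\<in>S. w p * w q * (f p * g p q)) = w p * f p * (\<Sum>q\<in>S. w q * g p q)" for p
      by (simp add: sum_distrib_left mult_ac)
    then show ?thesis
      using that by simp
  qed
  have left: "(\<Sum>p\<in>S. \<Sum>q\<in>S. w p * w q * (f q * g p q)) = 0"
    if "\<And>p. (\<Sum>q\<in>S. w q * g q p) = 0" for f and g :: "'n heisenberg \<Rightarrow> 'n heisenberg \<Rightarrow> real"
    using right [of "\<lambda>p q. g q p" f] that
    by (subst sum.swap) (simp add: mult_ac)
  have hsym: "Re (h p q) = Re (h q p)" "Im (h p q) = - Im (h q p)" for p q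
    by (simp_all add: h_def hermitian_commute [of "fst p" "fst q"])
  have hR: "(\<Sum>q\<in>S. w q * Re (h p q)) = 0" "(\<Sum>q\<in>S. w q * Re (h q p)) = 0"
    and hI: "(\<Sum>q\<in>S. w q * Im (h p q)) = 0" "(\<Sum>q\<in>S. w q * Im (h q p)) = 0" for p
    using wRe [of "fst p"] wIm [of "fst p"]
    by (simp_all add: hsym [of _ p] sum_negf) (simp_all add: h_def)
  have "(\<Sum>p\<in>S. \<Sum>q\<in>S. w p * w q * cygan_dist p q ^ 4)
      = (\<Sum>p\<in>S. \<Sum>q\<in>S. w p * w q * (N p * N p + snd p * snd p))
      + (\<Sum>p\<in>S. \<Sum>q\<in>S. w p * w q * (2 * N p * N q))
      - (\<Sum>p\<in>S. \<Sum>q\<in>S. w p * w q * (2 * snd p * snd q))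
      - (\<Sum>p\<in>S. \<Sum>q\<in>S. w p * w q * (4 * N p * Re (h p q)))
      + (\<Sum>p\<in>S. \<Sum>q\<in>S. w p * w q * (4 * snd p * Im (h p q)))
      - (\<Sum>p\<in>S. \<Sum>q\<in>S. w p * w q * (4 * N q * Re (h p q)))
      - (\<Sum>p\<in>S. \<Sum>q\<in>S. w p * w q * (4 * snd q * Im (h p q)))
      + (\<Sum>p\<in>S. \<Sum>q\<in>S. w p * w q * (N q * N q + snd q * snd q))
      + (\<Sum>p\<in>S. \<Sum>q\<in>S. w p * w q * (4 * (cmod (h p q))\<^sup>2))"
    unfolding d B_def sum.distrib [symmetric] sum_subtractf [symmetric]
    by (intro sum.cong refl) (simp add: algebra_simps)
  also have "\<dots> = (\<Sum>p\<in>S. \<Sum>q\<in>S. w p * w q * (2 * N p * N q))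
      + (\<Sum>p\<in>S. \<Sum>q\<in>S. w p * w q * (4 * (cmod (h p q))\<^sup>2))"
    using wt hR hI right [of "\<lambda>_ _. 1"] left [of "\<lambda>_ _. 1"]
    by (simp only: right left mult_1_right w0 add_0_left add_0_right diff_0_right)
  also have "(\<Sum>p\<in>S. \<Sum>q\<in>S. w p * w q * (2 * N p * N q)) = 2 * (\<Sum>p\<in>S. w p * N p)\<^sup>2"
    by (simp add: power2_eq_square sum_product sum_distrib_left mult_ac)
  also have "(\<Sum>p\<in>S. \<Sum>q\<in>S. w p * w q * (4 * (cmod (h p q))\<^sup>2))
      = 4 * (\<Sum>p\<in>S. \<Sum>q\<in>S. w p * w q * (cmod (h p q))\<^sup>2)"
    by (simp add: sum_distrib_left mult_ac)
  finally show ?thesis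
    using sum_sum_norm_hermitian_nonneg [of w fst S] by (simp add: h_def)
qed

lemma cygan_equilateral_card_le:
  fixes S :: "'n::finite heisenberg set"
  assumes eq: "cygan.equilateral S" and fin: "finite S"
  shows "card S \<le> 2 * CARD('n) + 2"
proof (rule ccontr)
  assume "\<not> ?thesis"
  then have "card S \<ge> DIM('n heisenberg) + 2"
    by simp
  then have "affine_dependent S"
    using affine_dependent_biggerset [OF fin] by simp
  then obtain w v where w: "sum w S = 0" "(\<Sum>p\<in>S. w p *\<^sub>R p) = 0" and v: "v \<in> S" "w v \<noteq> 0"
    using affine_dependent_explicit_finite [OF fin] by blast
  obtain c where c: "\<And>p q. p \<in> S \<Longrightarrow> q \<in> S \<Longrightarrow> p \<noteq> q \<Longrightarrow> cygan_dist p q = c"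
    using eq by (auto simp: cygan.equilateral_def pairwise_def)
  \<comment> \<open>Otherwise \<open>sum w S = w v\<close>, which is nonzero. A second point then
    gives \<open>c \<noteq> 0\<close>.\<close>
  have "S \<noteq> {v}"
    using w(1) v by auto
  with v obtain u where "u \<in> S" "u \<noteq> v"
    by blast
  with c v have "c \<noteq> 0"
    using cygan.zero by blast
  \<comment> \<open>With \<open>c ^ 4\<close> on the diagonal too, the row would sum to 0 because
    \<open>sum w S = 0\<close>; only the correction at \<open>q = p\<close> survives.\<close>
  have row: "(\<Sum>q\<in>S. w p * w q * cygan_dist p q ^ 4) = - (c ^ 4 * (w p)\<^sup>2)" if "p \<in> S" for p
  proof -
    have "(\<Sum>q\<in>S. w p * w q * cygan_dist p q ^ 4)
        = (\<Sum>q\<in>S. c ^ 4 * w p * w q - (if q = p then c ^ 4 * (w p)\<^sup>2 else 0))"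
      by (intro sum.cong refl) (auto simp: c that power2_eq_square)
    also have "\<dots> = - (c ^ 4 * (w p)\<^sup>2)"
      using that fin w(1) by (simp add: sum_subtractf flip: sum_distrib_left)
    finally show ?thesis .
  qed
  have "(\<Sum>p\<in>S. \<Sum>q\<in>S. w p * w q * cygan_dist p q ^ 4) = - (c ^ 4 * (\<Sum>p\<in>S. (w p)\<^sup>2))"
    by (simp add: row sum_negf flip: sum_distrib_left)
  moreover have "0 < (\<Sum>p\<in>S. (w p)\<^sup>2)"
    by (rule sum_pos2 [OF fin v(1)]) (use v in auto)
  moreover have "0 < c ^ 4"
    using \<open>c \<noteq> 0\<close> by simp
  ultimately show False
    using cygan_affine_dependence_nonneg [OF w] by (smt (verit) mult_pos_pos)
qed

text \<open>Since \<open>card\<close> is 0 on infinite sets, a cardinality bound alone cannot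
  exclude them; a finite subset with one point too many does.\<close>

lemma cygan_equilateral_finite:
  fixes S :: "'n::finite heisenberg set"
  assumes "cygan.equilateral S"
  shows "finite S"
proof (rule ccontr)
  assume "infinite S"
  then obtain T where "T \<subseteq> S" "finite T" "card T = 2 * CARD('n) + 3"
    using infinite_arbitrarily_large by blast
  moreover from this assms have "cygan.equilateral T"
    by (auto simp: cygan.equilateral_def intro: pairwise_subset)
  ultimately show False
    using cygan_equilateral_card_le [of T] by simp
qed

section \<open>Lower bound\<close>

text \<open>Up to isometry, these are the projections of the n + 1 standard basis vectors of R^(n+1)
  to the hyperplane of coordinate sum 0.\<close>

fun simplex_vertex :: "'n::finite option \<Rightarrow> complex ^ 'n" where
  "simplex_vertex None = (\<chi> i. - of_real (1 / sqrt (real CARD('n) + 1)))"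
| "simplex_vertex (Some k) =
    (\<chi> i. of_bool (i = k) - of_real ((1 - 1 / sqrt (real CARD('n) + 1)) / real CARD('n)))"

lemma hermitian_simplex_vertex:
  fixes j k :: "'n::finite option"
  shows "hermitian (simplex_vertex j) (simplex_vertex k) = of_bool (j = k) - 1 / (of_nat CARD('n) + 1)"
proof -
  define n where "n = real CARD('n)"
  define u where "u = 1 / sqrt (n + 1)"
  define l where "l = (1 - u) / n"
  have n: "n > 0"
    by (simp add: n_def)
  then have u2: "u * u = 1 / (n + 1)"
    by (simp add: u_def)
  have ln: "n * l = 1 - u"
    using n by (simp add: l_def)
  \<comment> \<open>Since \<open>l * n - 2 = - (1 + u)\<close>, multiplying by
    \<open>l = (1 - u) / n\<close> gives a difference of squares.\<close>
  have "l * l * n - 2 * l = - (1 - u * u) / n"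
    using n by (simp add: l_def field_simps)
  also have "1 - u * u = n / (n + 1)"
    using n by (simp add: u2 field_simps)
  also have "- (n / (n + 1)) / n = - 1 / (n + 1)"
    using n by simp
  finally have ll: "l * l * n - 2 * l = - 1 / (n + 1)" .
  have lu: "u * (l * n) - u = - 1 / (n + 1)"
    using u2 ln by (simp add: mult.commute [of l] right_diff_distrib)
  have s: "(simplex_vertex None :: complex ^ 'n) = (\<chi> i. - of_real u)"
    "simplex_vertex (Some i) = (\<chi> j. of_bool (j = i) - of_real l)" for i :: 'n
    by (simp_all only: simplex_vertex.simps u_def l_def n_def)
  have [simp]: "complex_of_nat CARD('n) = of_real n"
    by (simp add: n_def)
  have [simp]: "cnj (of_bool P) = of_bool P" for P
    by (cases P) simp_all
  have "\<exists>r. hermitian (simplex_vertex j) (simplex_vertex k) = of_real r \<and> r = of_bool (j = k) - 1 / (n + 1)"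
  proof (cases j; cases k)
    show ?thesis if "j = None" "k = None"
      using that u2 n unfolding that s hermitian_def
      by (intro exI [of _ "n * (u * u)"]) (simp add: field_simps)
    show ?thesis if "j = None" "k = Some b" for b
      using that lu unfolding that s hermitian_def
      by (intro exI [of _ "u * (l * n) - u"])
        (simp add: algebra_simps sum.distrib sum_subtractf)
    show ?thesis if "j = Some a" "k = None" for a
      using that lu unfolding that s hermitian_def
      by (intro exI [of _ "u * (l * n) - u"])
        (simp add: algebra_simps sum.distrib sum_subtractf)
    show ?thesis if "j = Some a" "k = Some b" for a b
      using that ll unfolding that s hermitian_def
      by (intro exI [of _ "of_bool (a = b) + (l * l * n - 2 * l)"])
        (simp add: algebra_simps sum.distrib sum_subtractf)
  qed
  then show ?thesis
    by auto
qed

text \<open>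
  In the construction, \<open>\<bar>b\<bar>\<close> and \<open>\<bar>b - g\<bar>\<close> are the squared distances between points of different kinds over
  distinct vertices and over the same vertex, and \<open>g = 2 \<alpha> cnj \<beta>\<close>. The last equation is the
  condition for the real parts; the imaginary parts are absorbed by \<open>\<tau>\<close>.
\<close>

lemma exists_equilateral_angles:
  fixes n :: real
  assumes "n \<ge> 0"
  obtains b g where "cmod b = 1" "cmod g = 1" "cmod (b - g) = 1" "Re (b - g) = n * (1 - Re b)"
proof -
  \<comment> \<open>The moduli say that 0, \<open>b\<close>, \<open>g\<close> form an equilateral
    triangle. With \<open>b = cis \<theta>\<close> and \<open>g = cis (\<theta> - pi / 3)\<close>, a
    zero of \<open>f\<close> is the remaining equation.\<close>
  define f where "f \<theta> = n * (1 - cos \<theta>) - cos (\<theta> + pi / 3)" for \<theta>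
  have "\<exists>\<theta>\<ge>0. \<theta> \<le> pi / 6 \<and> f \<theta> = 0"
  proof (rule IVT')
    show "f 0 \<le> 0"
      by (simp add: f_def cos_60)
    have "pi / 6 + pi / 3 = pi / 2"
      by simp
    then show "0 \<le> f (pi / 6)"
      using assms by (simp add: f_def del: divide_eq_eq)
  qed (auto simp: f_def intro!: continuous_intros)
  then obtain \<theta> where "f \<theta> = 0"
    by blast
  show ?thesis
  proof
    have *: "cis \<theta> - cis (\<theta> - pi / 3) = cis (\<theta> + pi / 3)"
      by (simp add: complex_eq_iff cos_add cos_diff sin_add sin_diff cos_60 sin_60)
    show "cmod (cis \<theta> - cis (\<theta> - pi / 3)) = 1"
      "Re (cis \<theta> - cis (\<theta> - pi / 3)) = n * (1 - Re (cis \<theta>))"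
      unfolding * using \<open>f \<theta> = 0\<close> by (simp_all add: f_def)
  qed auto
qed

lemma cygan_equilateral_exists:
  "\<exists>S :: 'n::finite heisenberg set. cygan.equilateral S \<and> finite S \<and> card S = 2 * CARD('n) + 2"
proof -
  define n where "n = real CARD('n)"
  define m where "m = n + 1"
  have m: "m > 0"
    by (simp add: m_def n_def)
  obtain b g where b: "cmod b = 1" and g: "cmod g = 1" and bg: "cmod (b - g) = 1"
    and Re: "Re (b - g) = n * (1 - Re b)"
    by (rule exists_equilateral_angles [of n]) (simp add: n_def)
  \<comment> \<open>\<open>\<tau>\<close> matches the imaginary parts in \<open>b_eq\<close>.
    \<open>c True\<close> and \<open>c False\<close> are \<open>\<alpha>\<close> and
    \<open>\<beta>\<close>, so \<open>2 * \<alpha> * cnj \<beta> = g\<close>.\<close>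
  define \<tau> where "\<tau> = Im g / m - Im b"
  define c where "c \<sigma> = (if \<sigma> then 1 else cnj g) / sqrt 2" for \<sigma>
  define P :: "'n option \<times> bool \<Rightarrow> 'n heisenberg" where
    "P = (\<lambda>(j, \<sigma>). (c \<sigma> *s simplex_vertex j, if \<sigma> then \<tau> else 0))"
  \<comment> \<open>The right side is the number whose modulus is the squared distance between
    points of different kinds over distinct vertices; over the same vertex, \<open>g\<close> is
    subtracted.\<close>
  have b_eq: "b = 1 - 1 / m + g / m - \<i> * \<tau>"
  proof -
    have "m * Re b = n + Re g"
      using Re by (simp add: m_def algebra_simps)
    then have "Re b = (m - 1 + Re g) / m"
      using m by (simp add: m_def field_simps)
    also have "\<dots> = 1 - 1 / m + Re g / m"
      using m by (simp add: add_divide_distrib diff_divide_distrib)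
    finally have "Re b = 1 - 1 / m + Re g / m" .
    then show ?thesis
      by (simp add: complex_eq_iff \<tau>_def)
  qed
  have c2: "c \<sigma> * cnj (c \<sigma>) = 1 / 2" for \<sigma>
    using g by (simp add: c_def mult.commute [of "cnj g"] flip: complex_norm_square of_real_mult)
  have simplex_vertex: "hermitian (simplex_vertex j) (simplex_vertex k) = of_bool (j = k) - 1 / of_real m"
    for j k :: "'n option"
    by (simp add: hermitian_simplex_vertex m_def n_def)
  have norm: "(norm (c \<sigma> *s simplex_vertex j))\<^sup>2 = (1 - 1 / m) / 2" for \<sigma> and j :: "'n option"
  proof -
    have "complex_of_real ((norm (c \<sigma> *s simplex_vertex j))\<^sup>2) = of_real ((1 - 1 / m) / 2)"
      unfolding hermitian_self [symmetric] hermitian_scale_left hermitian_scale_right simplex_vertex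
      by (simp add: c2 mult.commute [of "cnj (c \<sigma>)"] flip: mult.assoc)
    then show ?thesis
      by (simp only: of_real_eq_iff)
  qed
  have dist: "(cygan_dist (P (j, \<sigma>)) (P (k, \<rho>)))\<^sup>2
      = cmod (1 - 1 / m - \<i> * ((if \<sigma> then \<tau> else 0) - (if \<rho> then \<tau> else 0))
          - 2 * (c \<sigma> * cnj (c \<rho>)) * (of_bool (j = k) - 1 / m))" for j k \<sigma> \<rho>
    unfolding P_def prod.case cygan_dist_power2 norm hermitian_scale_left hermitian_scale_right
      simplex_vertex by (simp add: mult_ac)
  have c_True_False: "2 * (c True * cnj (c False)) = g"
    by (simp add: c_def flip: of_real_mult)
  \<comment> \<open>As \<open>2 * (c \<sigma> * cnj (c \<sigma>)) = 1\<close>, the two terms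
    \<open>1 / m\<close> cancel.\<close>
  have same: "cygan_dist (P (j, \<sigma>)) (P (k, \<sigma>)) = 1" if "j \<noteq> k" for j k \<sigma>
  proof -
    have "(cygan_dist (P (j, \<sigma>)) (P (k, \<sigma>)))\<^sup>2 = 1"
      unfolding dist c2 using that by simp
    then show ?thesis
      by (intro power2_eq_imp_eq [of _ 1]) (simp_all add: cygan.nonneg)
  qed
  have different: "cygan_dist (P (j, True)) (P (k, False)) = 1" for j k
  proof -
    have "(cygan_dist (P (j, True)) (P (k, False)))\<^sup>2 = cmod (b - of_bool (j = k) * g)"
      unfolding dist c_True_False by (subst b_eq) (simp add: algebra_simps)
    also have "\<dots> = 1"
      using b bg by simp
    finally show ?thesis
      by (intro power2_eq_imp_eq [of _ 1]) (simp_all add: cygan.nonneg)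
  qed
  have P: "cygan_dist (P x) (P y) = 1" if "x \<noteq> y" for x y
  proof -
    obtain j \<sigma> k \<rho> where xy: "x = (j, \<sigma>)" "y = (k, \<rho>)"
      by (cases x; cases y)
    have "cygan_dist (P (k, False)) (P (j, True)) = 1"
      using different [of j k] by (simp only: cygan.commute)
    moreover have "cygan_dist (P (j, False)) (P (k, True)) = 1"
      using different [of k j] by (simp only: cygan.commute)
    ultimately show ?thesis
      using that same different unfolding xy by (cases \<sigma>; cases \<rho>) auto
  qed
  have "inj P"
    by (rule injI) (metis P cygan.zero UNIV_I zero_neq_one)
  then have "card (range P) = 2 * CARD('n) + 2"
    by (simp add: card_image card_UNIV_option)
  moreover have "cygan.equilateral (range P)"
    by (auto simp: cygan.equilateral_def pairwise_def intro!: exI [of _ 1] P)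
  ultimately show ?thesis
    by (intro exI [of _ "range P"]) simp
qed

theorem theorem1p1:
  shows "Metric_space.equilateral_dim (UNIV :: 'n::finite heisenberg set) cygan_dist
           = enat (2 * CARD('n) + 2)
       \<and> (\<exists>S :: 'n heisenberg set. Metric_space.equilateral UNIV cygan_dist S
             \<and> finite S \<and> card S = 2 * CARD('n) + 2)
       \<and> (\<forall>S :: 'n heisenberg set. Metric_space.equilateral UNIV cygan_dist S
             \<longrightarrow> finite S \<and> card S \<le> 2 * CARD('n) + 2)"
proof (intro conjI allI impI)
  obtain S :: "'n heisenberg set"
    where S: "cygan.equilateral S" "finite S" "card S = 2 * CARD('n) + 2"
    using cygan_equilateral_exists by blast
  show "Metric_space.equilateral_dim (UNIV :: 'n heisenberg set) cygan_dist
      = enat (2 * CARD('n) + 2)"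
    unfolding Metric_space.equilateral_dim_def [OF Metric_space_cygan]
  proof (rule antisym)
    show "(SUP S \<in> {S :: 'n heisenberg set. finite S \<and> cygan.equilateral S}. enat (card S))
        \<le> enat (2 * CARD('n) + 2)"
      by (rule SUP_least) (use cygan_equilateral_card_le in auto)
    show "enat (2 * CARD('n) + 2)
        \<le> (SUP S \<in> {S :: 'n heisenberg set. finite S \<and> cygan.equilateral S}. enat (card S))"
      by (rule SUP_upper2 [of S]) (use S in auto)
  qed
qed (use cygan_equilateral_exists cygan_equilateral_finite cygan_equilateral_card_le in blast)+

end
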